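(* There exists a sentence $\psi$ of the logic ${\cal R}ing(0,+,*,<)$ such that its prime spectrum $Sp(\psi)$ has no natural density, i.e. the limit $\lim_{n\to\infty}\pi_{Sp(\psi)}(n)/\pi(n)$ does not exist.
   Context: For an integer $m\ge 1$, $\mathbb{Z}_m$ denotes the finite residue class ring with universe $\{0,1,\ldots,m-1\}$, addition and multiplication modulo $m$. The logic ${\cal R}ing(0,+,* )$ is the set of first-order sentences over the vocabulary consisting of a constant symbol $0$ and binary function symbols $+$ and $*$; its models are the rings $\mathbb{Z}_m$, with $0$ interpreted as the residue class $0$ and $+,*$ as addition and multiplication mod $m$. The logic ${\cal R}ing(0,+,*,<)$ additionally has a binary relation symbol $<$, interpreted in $\mathbb{Z}_m$ as the natural order of the representatives $0<1<\cdots<m-1$. The prime spectrum of a sentence $\sigma$ is $Sp(\sigma)=\{p \text{ prime} : \mathbb{Z}_p\models\sigma\}$. For a real $x>0$, $\pi(x)$ is the number of primes $\le x$, and for a set $S$ of primes, $\pi_S(x)=|\{q\in S: q\le x\}|$. A set $S$ of primes has natural density if $\lim_{n\to\infty}\pi_S(n)/\pi(n)$ (over natural numbers $n$) exists. *)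

theory Defs
  imports Complex_Main "HOL-Number_Theory.Residues"
begin

text \<open>First-order logic with equality over the vocabulary \<open>0, +, *, <\<close>; variables are named by
  natural numbers.\<close>

datatype ring_term =
    Var nat
  | Zero
  | Add ring_term ring_term
  | Mul ring_term ring_term

datatype ring_formula =
    Equal ring_term ring_term
  | Less ring_term ring_term
  | Not ring_formula
  | And ring_formula ring_formula
  | Or ring_formula ring_formula
  | Imp ring_formula ring_formula
  | Forall nat ring_formula
  | Exists nat ring_formula

primrec term_vars :: "ring_term \<Rightarrow> nat set" where
  "term_vars (Var v) = {v}"
| "term_vars Zero = {}"
| "term_vars (Add s t) = term_vars s \<union> term_vars t"
| "term_vars (Mul s t) = term_vars s \<union> term_vars t"

primrec free_vars :: "ring_formula \<Rightarrow> nat set" where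
  "free_vars (Equal s t) = term_vars s \<union> term_vars t"
| "free_vars (Less s t) = term_vars s \<union> term_vars t"
| "free_vars (Not f) = free_vars f"
| "free_vars (And f g) = free_vars f \<union> free_vars g"
| "free_vars (Or f g) = free_vars f \<union> free_vars g"
| "free_vars (Imp f g) = free_vars f \<union> free_vars g"
| "free_vars (Forall v f) = free_vars f - {v}"
| "free_vars (Exists v f) = free_vars f - {v}"

definition sentence :: "ring_formula \<Rightarrow> bool" where
  "sentence f \<longleftrightarrow> free_vars f = {}"

primrec term_value :: "('a, 'b) ring_scheme \<Rightarrow> (nat \<Rightarrow> 'a) \<Rightarrow> ring_term \<Rightarrow> 'a" where
  "term_value R e (Var v) = e v"
| "term_value R e Zero = \<zero>\<^bsub>R\<^esub>"
| "term_value R e (Add s t) = term_value R e s \<oplus>\<^bsub>R\<^esub> term_value R e t"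
| "term_value R e (Mul s t) = term_value R e s \<otimes>\<^bsub>R\<^esub> term_value R e t"

primrec satisfies ::
    "('a, 'b) ring_scheme \<Rightarrow> ('a \<Rightarrow> 'a \<Rightarrow> bool) \<Rightarrow> (nat \<Rightarrow> 'a) \<Rightarrow> ring_formula \<Rightarrow> bool" where
  "satisfies R lt e (Equal s t) \<longleftrightarrow> term_value R e s = term_value R e t"
| "satisfies R lt e (Less s t) \<longleftrightarrow> lt (term_value R e s) (term_value R e t)"
| "satisfies R lt e (Not f) \<longleftrightarrow> \<not> satisfies R lt e f"
| "satisfies R lt e (And f g) \<longleftrightarrow> satisfies R lt e f \<and> satisfies R lt e g"
| "satisfies R lt e (Or f g) \<longleftrightarrow> satisfies R lt e f \<or> satisfies R lt e g"
| "satisfies R lt e (Imp f g) \<longleftrightarrow> (satisfies R lt e f \<longrightarrow> satisfies R lt e g)"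
| "satisfies R lt e (Forall v f) \<longleftrightarrow> (\<forall>a\<in>carrier R. satisfies R lt (e(v := a)) f)"
| "satisfies R lt e (Exists v f) \<longleftrightarrow> (\<exists>a\<in>carrier R. satisfies R lt (e(v := a)) f)"

text \<open>The carrier of \<open>residue_ring (int m)\<close> is the set \<open>{0..int m - 1}\<close> of representatives, so
  the order of \<open>int\<close> restricted to it is the natural order of the representatives.\<close>

definition Zmod_models :: "nat \<Rightarrow> ring_formula \<Rightarrow> bool" where
  "Zmod_models m f \<longleftrightarrow>
     (\<forall>e. range e \<subseteq> carrier (residue_ring (int m)) \<longrightarrow> satisfies (residue_ring (int m)) (<) e f)"

definition prime_spectrum :: "ring_formula \<Rightarrow> nat set" where
  "prime_spectrum f = {p. prime p \<and> Zmod_models p f}"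

definition count_upto :: "nat set \<Rightarrow> real \<Rightarrow> nat" where
  "count_upto S x = card {q \<in> S. real q \<le> x}"

definition prime_count :: "real \<Rightarrow> nat" where
  "prime_count x = card {p :: nat. prime p \<and> real p \<le> x}"

text \<open>The quotient is \<open>0\<close> by convention for \<open>n < 2\<close>, which does not affect the limit.\<close>

definition has_natural_density :: "nat set \<Rightarrow> bool" where
  "has_natural_density S \<longleftrightarrow>
     (\<exists>d :: real. (\<lambda>n :: nat. real (count_upto S (real n)) / real (prime_count (real n)))
        \<longlonglongrightarrow> d)"

end

theory Submission
  imports Defs
begin

text \<open>
  For \<open>y < p\<close> one has \<open>y\<^sup>2 < p\<close> iff squaring modulo \<open>p\<close> is strictly increasing on \<open>{0..y}\<close>, because
  the first square to exceed \<open>p\<close> wraps around to a smaller residue. So "being below the square root of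
  \<open>p\<close>" is definable from the order, and products of two such elements agree with the integer product.
  Hence divisibility, and with it being a power of two, is definable for elements below the square
  root, and a sentence can express that the largest power of two \<open>2^k\<close> with \<open>16^k < p\<close> is a square.
  Its spectrum consists of the primes in the intervals \<open>(16^(2j), 16^(2j+1)]\<close>. Chebyshev's bounds at
  powers of two show that \<open>\<pi>(16^k)\<close> at least triples from each large \<open>k\<close> to the next, so the
  relative count is at most \<open>1/3\<close> at even and at least \<open>2/3\<close> at odd powers of 16.
\<close>

subsection \<open>A sentence about the size of the modulus\<close>

lemma term_value_upd:
  "v \<notin> term_vars t \<Longrightarrow> term_value R (e(v := a)) t = term_value R e t"
  by (induction t) auto

lemma residue_ring_simps [simp]:
  "carrier (residue_ring m) = {0..m - 1}"
  "x \<oplus>\<^bsub>residue_ring m\<^esub> y = (x + y) mod m"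
  "x \<otimes>\<^bsub>residue_ring m\<^esub> y = (x * y) mod m"
  "\<zero>\<^bsub>residue_ring m\<^esub> = 0"
  by (simp_all add: residue_ring_def)

lemma square_less_iff_squares_mod_mono:
  fixes y p :: int
  assumes "0 \<le> y" "y < p" "1 < p"
  shows "y * y < p \<longleftrightarrow>
    (\<forall>z\<in>{0..p - 1}. \<forall>u\<in>{0..p - 1}. z < u \<and> \<not> y < u \<longrightarrow> (z * z) mod p < (u * u) mod p)"
    (is "_ \<longleftrightarrow> ?mono")
proof
  assume y: "y * y < p"
  show ?mono
  proof (intro ballI impI)
    fix z u assume zu: "z \<in> {0..p - 1}" "u \<in> {0..p - 1}" "z < u \<and> \<not> y < u"
    have "z * z < u * u" using zu by (intro mult_strict_mono) auto
    moreover have "u * u \<le> y * y" using zu by (intro mult_mono) auto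
    ultimately show "(z * z) mod p < (u * u) mod p" using y zu by simp
  qed
next
  assume mono: ?mono
  show "y * y < p"
  proof (rule ccontr)
    assume "\<not> y * y < p"
    then have ex: "\<exists>n::nat. p \<le> int n * int n" using assms by (intro exI[of _ "nat y"]) auto
    \<comment> \<open>Here \<open>n = z + 1\<close> is the first integer whose square reaches
      \<open>p\<close>; the pair \<open>z\<close>, \<open>n\<close> will violate
      monotonicity.\<close>
    define n where "n = (LEAST n::nat. p \<le> int n * int n)"
    have n: "p \<le> int n * int n" unfolding n_def by (rule LeastI_ex[OF ex])
    have ny: "n \<le> nat y" unfolding n_def using \<open>\<not> y * y < p\<close> assms by (intro Least_le) auto
    obtain m where m: "n = Suc m" using n assms by (cases n) auto
    define z where "z = int m"
    have z2: "z * z < p" using not_less_Least[of m "\<lambda>n. p \<le> int n * int n"] m n_def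
      by (simp add: z_def)
    have u: "int n = z + 1" by (simp add: m z_def)
    have "z + 1 \<le> y" using ny u assms by linarith
    have "z \<ge> 1" using n u assms by (cases "z = 0") (auto simp: z_def)
    \<comment> \<open>The step from \<open>z * z\<close> to the next square is at most
      \<open>p\<close>, so after one subtraction of \<open>p\<close> the residue is at most
      \<open>z * z\<close>. The bound \<open>2 * z \<le> z * z\<close> fails only for
      \<open>z = 1\<close>, where \<open>2 \<le> y < p\<close> suffices.\<close>
    have wrap: "2 * z + 1 \<le> p"
    proof (cases "z = 1")
      case True
      then show ?thesis using \<open>z + 1 \<le> y\<close> assms by simp
    next
      case False
      then have "2 * z \<le> z * z" using \<open>z \<ge> 1\<close> by (intro mult_right_mono) auto
      then show ?thesis using z2 by linarith
    qed
    have "(z + 1) * (z + 1) - p < p" using z2 wrap by (simp add: algebra_simps)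
    moreover have "(z + 1) * (z + 1) - p \<ge> 0" using n u by simp
    ultimately have "((z + 1) * (z + 1)) mod p = (z + 1) * (z + 1) - p"
      by (metis mod_pos_pos_trivial minus_mod_self2)
    then have "((z + 1) * (z + 1)) mod p \<le> (z * z) mod p"
      using wrap z2 \<open>z \<ge> 1\<close> by (simp add: algebra_simps)
    moreover have "(z * z) mod p < ((z + 1) * (z + 1)) mod p"
      using mono \<open>z + 1 \<le> y\<close> \<open>z \<ge> 1\<close> assms by auto
    ultimately show False by simp
  qed
qed

text \<open>A positive integer is a power of two iff each of its divisors except 1 is even. The
  vocabulary has no constant 1, so "the divisor \<open>a\<close> is 1" is phrased through its
  cofactor as \<open>b = v\<close>. Requiring \<open>c < a\<close> makes \<open>c + c\<close> an
  unreduced sum and rules out \<open>a = 0\<close>.\<close>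

lemma power_of_two_iff_divisors_even:
  fixes v p :: int
  assumes "0 \<le> v" "v * v < p" "1 < p"
  shows "(\<exists>k. v = 2 ^ k) \<longleftrightarrow>
    (\<forall>a\<in>{0..p - 1}. \<forall>b\<in>{0..p - 1}. a * a < p \<and> b * b < p \<and> (a * b) mod p = v \<longrightarrow>
      b = v \<or> (\<exists>c\<in>{0..p - 1}. c < a \<and> (c + c) mod p = a))" (is "_ \<longleftrightarrow> ?divs")
proof
  assume "\<exists>k. v = 2 ^ k"
  then obtain k where k: "v = 2 ^ k" ..
  show ?divs
  proof (intro ballI impI)
    fix a b assume ab: "a \<in> {0..p - 1}" "b \<in> {0..p - 1}"
      "a * a < p \<and> b * b < p \<and> (a * b) mod p = v"
    have "a * b < p"
    proof (cases "a \<le> b")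
      case True
      then have "a * b \<le> b * b" using ab by (intro mult_right_mono) auto
      then show ?thesis using ab by simp
    next
      case False
      then have "a * b \<le> a * a" using ab by (intro mult_left_mono) auto
      then show ?thesis using ab by simp
    qed
    then have eq: "a * b = 2 ^ k" using ab k by simp
    then have "nat a dvd 2 ^ k"
      by (metis ab(1) atLeastAtMost_iff dvd_triv_left nat_dvd_iff int_nat_eq of_nat_numeral of_nat_power of_nat_dvd_iff)
    then obtain i where "nat a = 2 ^ i" by (auto simp: divides_primepow_nat)
    then have i: "a = 2 ^ i" using ab by (metis atLeastAtMost_iff int_nat_eq of_nat_numeral of_nat_power)
    show "b = v \<or> (\<exists>c\<in>{0..p - 1}. c < a \<and> (c + c) mod p = a)"
    proof (cases i)
      case 0
      then show ?thesis using i eq k by simp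
    next
      case (Suc l)
      then have "a = 2 ^ l + 2 ^ l" "(0::int) < 2 ^ l" using i by simp_all
      then show ?thesis using ab by (intro disjI2 bexI[of _ "2 ^ l"]) auto
    qed
  qed
next
  assume divs: ?divs
  have "v \<noteq> 0"
  proof
    \<comment> \<open>The factorization \<open>0 = 0 * 1\<close> violates the condition:
      \<open>b = 1\<close> is not \<open>v\<close>, and no \<open>c\<close> lies below 0.\<close>
    assume "v = 0"
    then show False using bspec[OF bspec[OF divs, of 0], of 1] assms by auto
  qed
  then have "nat v \<noteq> 0" using assms by simp
  \<comment> \<open>Test the condition on the odd part \<open>m\<close> with cofactor
    \<open>2 ^ k\<close>: unless \<open>m = 1\<close>, it would make \<open>m\<close> even.\<close>
  then obtain k m' where km: "nat v = 2 ^ k * m'" "odd m'"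
    by (rule multiplicity_decompose'[of "nat v" 2]) simp_all
  define m where "m = int m'"
  have v: "v = 2 ^ k * m" using km(1) assms unfolding m_def
    by (metis int_nat_eq of_nat_mult of_nat_numeral of_nat_power)
  have m: "odd m" "m > 0" using km(2) odd_pos by (auto simp: m_def)
  have "m = 1"
  proof (rule ccontr)
    assume "m \<noteq> 1"
    have le: "m \<le> v" "2 ^ k \<le> v" using m by (auto simp: v)
    have sq: "m * m \<le> v * v" "(2 ^ k) * (2 ^ k) \<le> v * v"
      using le m by (auto intro!: mult_mono)
    have "v < p"
      using assms \<open>v \<noteq> 0\<close> mult_right_mono[of 1 v v] by linarith
    have "2 ^ k \<noteq> v" using v m \<open>m \<noteq> 1\<close> by simp
    have "m * 2 ^ k = v" by (simp add: v)
    then have "\<exists>c\<in>{0..p - 1}. c < m \<and> (c + c) mod p = m"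
      using bspec[OF bspec[OF divs, of m], of "2 ^ k"] le sq m \<open>v < p\<close> \<open>2 ^ k \<noteq> v\<close> assms
      by auto
    then obtain c where c: "0 \<le> c" "c < m" "(c + c) mod p = m" by auto
    \<comment> \<open>A wrapped sum would have residue \<open>c + c - p < c < m\<close>.\<close>
    have "c + c < p"
    proof (rule ccontr)
      assume "\<not> c + c < p"
      then have "(c + c - p) mod p = c + c - p"
        using c le \<open>v < p\<close> by (intro mod_pos_pos_trivial) linarith+
      then show False using c le \<open>v < p\<close> by simp
    qed
    then have "m = 2 * c" using c by simp
    then show False using m by simp
  qed
  then show "\<exists>k. v = 2 ^ k" using v by auto
qed

section \<open>Formulas for the size condition and their meaning in residue rings\<close>

definition small :: "ring_term \<Rightarrow> ring_formula" where
  "small t = Forall 10 (Forall 11 (Imp (And (Less (Var 10) (Var 11)) (Not (Less t (Var 11))))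
     (Less (Mul (Var 10) (Var 10)) (Mul (Var 11) (Var 11)))))"

definition pow_two :: "ring_term \<Rightarrow> ring_formula" where
  "pow_two t = Forall 3 (Forall 4 (Imp
     (And (small (Var 3)) (And (small (Var 4)) (Equal (Mul (Var 3) (Var 4)) t)))
     (Or (Equal (Var 4) t)
       (Exists 5 (And (Less (Var 5) (Var 3)) (Equal (Add (Var 5) (Var 5)) (Var 3)))))))"

text \<open>The first conjunct makes \<open>Mul t t\<close> the true square, so the second says that
  the fourth power of \<open>t\<close> is below the modulus. For \<open>t = 2 ^ k\<close> this is
  \<open>16 ^ k < m\<close>, the origin of the base 16.\<close>

definition small_pow_two :: "ring_term \<Rightarrow> ring_formula" where
  "small_pow_two t = And (small t) (And (small (Mul t t)) (pow_two t))"

text \<open>Smallness of \<open>Var 1\<close> excludes square roots that exist only modulo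
  \<open>p\<close>, so the root certifies an even exponent.\<close>

definition even_log :: ring_formula where
  "even_log = Exists 0 (Exists 1 (And (small_pow_two (Var 0)) (And (small (Var 1))
     (And (Equal (Mul (Var 1) (Var 1)) (Var 0))
       (Forall 2 (Imp (small_pow_two (Var 2)) (Not (Less (Var 0) (Var 2)))))))))"

lemma sentence_even_log: "sentence even_log"
  by (auto simp: sentence_def even_log_def small_pow_two_def pow_two_def small_def)

text \<open>The conditions on 10 and 11 prevent variable capture; likewise \<open>v < 3\<close>
  below keeps \<open>v\<close> apart from the bound variables 3, 4, 5.\<close>

lemma satisfies_small:
  assumes "1 < m" "term_value (residue_ring m) e t \<in> {0..m - 1}" "10 \<notin> term_vars t" "11 \<notin> term_vars t"
  shows "satisfies (residue_ring m) (<) e (small t) \<longleftrightarrow>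
    term_value (residue_ring m) e t * term_value (residue_ring m) e t < m"
  unfolding small_def
  using assms by (simp add: square_less_iff_squares_mod_mono term_value_upd)

lemma satisfies_pow_two:
  assumes "1 < m" "e v \<in> {0..m - 1}" "e v * e v < m" "v < 3"
  shows "satisfies (residue_ring m) (<) e (pow_two (Var v)) \<longleftrightarrow> (\<exists>k. e v = 2 ^ k)"
  unfolding pow_two_def
  using assms by (simp add: satisfies_small power_of_two_iff_divisors_even)

lemma satisfies_small_pow_two:
  assumes "1 < m" "e v \<in> {0..m - 1}" "v < 3"
  shows "satisfies (residue_ring m) (<) e (small_pow_two (Var v)) \<longleftrightarrow>
    (\<exists>k. e v = 2 ^ k \<and> 16 ^ k < m)"
proof (cases "e v * e v < m")
  case True
  have "16 ^ k = (2 ^ k * 2 ^ k) * (2 ^ k * 2 ^ k :: int)" for k :: nat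
    by (simp flip: power_mult_distrib)
  then show ?thesis
    using True assms by (auto simp: small_pow_two_def satisfies_small satisfies_pow_two)
next
  case False
  \<comment> \<open>The formula fails at its first conjunct here, so the right side has to fail too:
    already \<open>4 ^ k\<close> is at least \<open>m\<close>.\<close>
  have "\<not> 16 ^ k < m" if "e v = 2 ^ k" for k
  proof -
    have "e v * e v = 4 ^ k" using that by (simp flip: power_mult_distrib)
    moreover have "(4::int) ^ k \<le> 16 ^ k" by (intro power_mono) auto
    ultimately show ?thesis using False by simp
  qed
  then show ?thesis using False assms by (auto simp: small_pow_two_def satisfies_small)
qed

lemma satisfies_even_log:
  assumes "1 < m"
  shows "satisfies (residue_ring m) (<) e even_log \<longleftrightarrow> (\<exists>j. 16 ^ (2 * j) < m \<and> m \<le> 16 ^ (2 * j + 1))"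
    (is "?L \<longleftrightarrow> ?R")
proof -
  have "?L \<longleftrightarrow> (\<exists>w\<in>{0..m - 1}. \<exists>z\<in>{0..m - 1}. (\<exists>k. w = 2 ^ k \<and> 16 ^ k < m) \<and> z * z < m \<and>
      (z * z) mod m = w \<and> (\<forall>v\<in>{0..m - 1}. (\<exists>k. v = 2 ^ k \<and> 16 ^ k < m) \<longrightarrow> \<not> w < v))"
    unfolding even_log_def using assms by (simp add: satisfies_small satisfies_small_pow_two)
  also have "\<dots> \<longleftrightarrow> ?R"
  proof
    assume ?R
    then obtain j where j: "16 ^ (2 * j) < m" "m \<le> 16 ^ (2 * j + 1)" by blast
    have le: "(2::int) ^ i \<le> 16 ^ i" for i :: nat by (intro power_mono) auto
    have "(2::int) ^ j \<le> 2 ^ (2 * j)" by (intro power_increasing) auto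
    then have z: "2 ^ j < m" "2 ^ (2 * j) < m" using le[of "2 * j"] j by linarith+
    have sq: "2 ^ j * 2 ^ j = (2::int) ^ (2 * j)" by (simp add: mult_2 power_add)
    have "\<not> 2 ^ (2 * j) < (2::int) ^ k" if "16 ^ k < m" for k
    proof -
      have "(16::int) ^ k < 16 ^ (2 * j + 1)" using that j by linarith
      then have "k \<le> 2 * j" by (simp only: power_strict_increasing_iff)
      then show ?thesis by (simp add: power_increasing not_less)
    qed
    then show "\<exists>w\<in>{0..m - 1}. \<exists>z\<in>{0..m - 1}. (\<exists>k. w = 2 ^ k \<and> 16 ^ k < m) \<and> z * z < m \<and>
      (z * z) mod m = w \<and> (\<forall>v\<in>{0..m - 1}. (\<exists>k. v = 2 ^ k \<and> 16 ^ k < m) \<longrightarrow> \<not> w < v)"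
      using j z sq by (intro bexI[of _ "2 ^ (2 * j)"] bexI[of _ "2 ^ j"]) auto
  next
    assume "\<exists>w\<in>{0..m - 1}. \<exists>z\<in>{0..m - 1}. (\<exists>k. w = 2 ^ k \<and> 16 ^ k < m) \<and> z * z < m \<and>
      (z * z) mod m = w \<and> (\<forall>v\<in>{0..m - 1}. (\<exists>k. v = 2 ^ k \<and> 16 ^ k < m) \<longrightarrow> \<not> w < v)"
    then obtain w z k where w: "w = 2 ^ k" and k: "16 ^ k < m"
      and z_mod: "z \<in> {0..m - 1}" "z * z < m" "(z * z) mod m = w"
      and max_w: "\<forall>v\<in>{0..m - 1}. (\<exists>k. v = 2 ^ k \<and> 16 ^ k < m) \<longrightarrow> \<not> w < v"
      by blast
    have z: "0 \<le> z" "z * z = 2 ^ k" using z_mod w by auto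
    have max: "2 ^ l \<le> w" if "2 ^ l \<in> {0..m - 1}" "16 ^ l < m" for l
      using bspec[OF max_w that(1)] that(2) by (auto simp: not_less)
    \<comment> \<open>A divisor of a power of two is a power of two, so comparing exponents in
      \<open>z * z = 2 ^ k\<close> makes \<open>k\<close> even.\<close>
    have "nat z dvd 2 ^ k"
      by (metis z dvd_triv_left nat_dvd_iff int_nat_eq of_nat_numeral of_nat_power of_nat_dvd_iff)
    then obtain j where "nat z = 2 ^ j" by (auto simp: divides_primepow_nat)
    then have "z = 2 ^ j" using z by (metis int_nat_eq of_nat_numeral of_nat_power)
    then have "(2::int) ^ (2 * j) = 2 ^ k" using z by (simp add: mult_2 power_add)
    then have kj: "k = 2 * j" by (simp only: power_inject_exp)
    have "m \<le> 16 ^ (k + 1)"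
    proof (rule ccontr)
      assume "\<not> m \<le> 16 ^ (k + 1)"
      then have less: "16 ^ (k + 1) < m" by simp
      \<comment> \<open>This places \<open>2 ^ (k + 1)\<close> in the universe, so maximality of
        \<open>w\<close> applies to it.\<close>
      have "(2::int) ^ (k + 1) \<le> 16 ^ (k + 1)" by (intro power_mono) auto
      then have "(2::int) ^ (k + 1) \<le> 2 ^ k" using less w max[of "k + 1"] by auto
      then show False by simp
    qed
    then show ?R using k kj by blast
  qed
  finally show ?thesis .
qed

lemma prime_spectrum_even_log:
  "prime_spectrum even_log = {p. prime p \<and> (\<exists>j. 16 ^ (2 * j) < p \<and> p \<le> 16 ^ (2 * j + 1))}"
proof -
  have "Zmod_models p even_log \<longleftrightarrow> (\<exists>j. 16 ^ (2 * j) < p \<and> p \<le> 16 ^ (2 * j + 1))"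
    if "prime p" for p
  proof -
    have p: "1 < int p" using prime_gt_1_nat[OF that] by simp
    \<comment> \<open>The truth value does not depend on the assignment; the zero assignment shows
      that there is one.\<close>
    have "Zmod_models p even_log \<longleftrightarrow> (\<exists>j. 16 ^ (2 * j) < int p \<and> int p \<le> 16 ^ (2 * j + 1))"
      unfolding Zmod_models_def satisfies_even_log[OF p]
      using p by (auto intro!: exI[of _ "\<lambda>_. 0"])
    also have "\<dots> \<longleftrightarrow> (\<exists>j. 16 ^ (2 * j) < p \<and> p \<le> 16 ^ (2 * j + 1))"
      by (metis of_nat_le_iff of_nat_less_iff of_nat_numeral of_nat_power)
    finally show ?thesis .
  qed
  then show ?thesis by (auto simp: prime_spectrum_def)
qed

subsection \<open>Chebyshev bounds at powers of two\<close>

definition num_primes :: "nat \<Rightarrow> nat" where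
  "num_primes n = card {p. prime p \<and> p \<le> n}"

text \<open>The numbers \<open>1 / (k * (n choose k))\<close> form Leibniz's harmonic triangle: the
  entry at \<open>(n, k + 1)\<close> is the entry at \<open>(n - 1, k)\<close> minus that at
  \<open>(n, k)\<close>. Multiplied by the lcm, both of the latter are integers by induction, hence
  so is the former.\<close>

lemma mult_choose_dvd_Lcm:
  assumes "1 \<le> k" "k \<le> n"
  shows "k * (n choose k) dvd Lcm {1..n}"
  using assms
proof (induction k arbitrary: n rule: dec_induct)
  case base
  then show ?case by (auto intro: dvd_Lcm)
next
  case (step k)
  define C where "C = real (n choose k)"
  define L where "L = Lcm {1..n}"
  have C: "C > 0" using step by (simp add: C_def)
  have absorb: "real (Suc k * (n choose Suc k)) = (real n - real k) * C"
    using binomial_absorb_comp[of n k] step binomial_absorption[of k "n"]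
    by (metis C_def Suc_leD binomial_absorption of_nat_diff of_nat_mult)
  have comp: "(real n - real k) * C = real n * real (n - 1 choose k)"
    using binomial_absorb_comp[of n k] step
    by (metis C_def Suc_leD of_nat_diff of_nat_mult)
  have "k * (n choose k) dvd L" unfolding L_def using step by simp
  then have i1: "real L / (real k * C) \<in> \<int>"
    unfolding C_def by (metis real_of_nat_div of_nat_mult Ints_of_nat)
  have "k * (n - 1 choose k) dvd Lcm {1..n - 1}" using step by simp
  also have "\<dots> dvd L" unfolding L_def by (rule Lcm_subset) auto
  finally have i2: "real L / (real k * real (n - 1 choose k)) \<in> \<int>"
    by (metis real_of_nat_div of_nat_mult Ints_of_nat)
  have pos: "real k > 0" "real n - real k > 0" "real (n - 1 choose k) > 0" "real n > 0"
    using step by auto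
  have pred: "real (n - 1 choose k) = (real n - real k) * C / real n" using comp pos by simp
  have "x / (b * ((a - b) * C / a)) - x / (b * C) = x / ((a - b) * C)"
    if "0 < b" "0 < a - b" "0 < a" for a b x :: real
    using that C by (simp add: divide_simps) (simp add: algebra_simps)
  then have "real L / (real k * real (n - 1 choose k)) - real L / (real k * C) =
      real L / ((real n - real k) * C)"
    unfolding pred using pos by blast
  then have "real L / real (Suc k * (n choose Suc k)) \<in> \<int>"
    using i1 i2 by (metis absorb Ints_diff)
  then obtain z where "real L / real (Suc k * (n choose Suc k)) = of_int z"
    by (auto elim: Ints_cases)
  moreover have "real (Suc k * (n choose Suc k)) > 0" unfolding absorb using pos C by simp
  ultimately have "real L = of_int z * real (Suc k * (n choose Suc k))"
    by (simp only: divide_eq_eq split: if_splits)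
  then have "int L = z * int (Suc k * (n choose Suc k))"
    by (metis of_int_eq_iff of_int_mult of_int_of_nat_eq)
  then show ?case unfolding L_def[symmetric] by (metis dvd_triv_right of_nat_dvd_iff)
qed

text \<open>The multiplicity of a prime in an lcm is the maximum of its multiplicities.\<close>

lemma prime_power_dvd_Lcm:
  fixes A :: "nat set"
  assumes "prime p" "finite A" "A \<noteq> {}" "0 \<notin> A" "p ^ e dvd Lcm A"
  shows "\<exists>a\<in>A. p ^ e dvd a"
  using assms(2-)
proof (induction A rule: finite_ne_induct)
  case (singleton x)
  then show ?case by simp
next
  case (insert x A)
  have nz: "x \<noteq> 0" "Lcm A \<noteq> 0" using insert by (auto simp: Lcm_0_iff)
  have "e \<le> multiplicity p (lcm x (Lcm A))"
    using insert.prems nz assms(1) by (intro multiplicity_geI) (auto simp: lcm_eq_0_iff)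
  then have "e \<le> multiplicity p x \<or> e \<le> multiplicity p (Lcm A)"
    using nz by (simp add: multiplicity_lcm assms(1) le_max_iff_disj)
  then have "p ^ e dvd x \<or> p ^ e dvd Lcm A" using multiplicity_dvd' by blast
  then show ?case using insert by auto
qed

text \<open>Each prime power dividing the binomial coefficient divides the lcm of
  \<open>1..n\<close>, hence some number up to \<open>n\<close>, and so is at most \<open>n\<close>.
  The coefficient is thus a product of at most \<open>num_primes n\<close> factors, each at most
  \<open>n\<close>.\<close>

lemma choose_le_power_num_primes:
  assumes "1 \<le> k" "k \<le> n"
  shows "n choose k \<le> n ^ num_primes n"
proof -
  define C where "C = n choose k"
  have C: "C \<noteq> 0" using assms by (simp add: C_def)
  have le: "p ^ e \<le> n" if p: "prime p" "p ^ e dvd C" for p e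
  proof -
    have "p ^ e dvd k * C" using p by simp
    also have "\<dots> dvd Lcm {1..n}" unfolding C_def by (rule mult_choose_dvd_Lcm[OF assms])
    finally obtain a where "a \<in> {1..n}" "p ^ e dvd a"
      using prime_power_dvd_Lcm[of p "{1..n}" e] p(1) assms by auto
    then show ?thesis by (auto dest: dvd_imp_le)
  qed
  have sub: "prime_factors C \<subseteq> {p. prime p \<and> p \<le> n}"
    using le[of _ 1] by (auto simp: in_prime_factors_iff)
  have "C = (\<Prod>p\<in>prime_factors C. p ^ multiplicity p C)"
    using C prime_factorization_nat by auto
  also have "\<dots> \<le> (\<Prod>p\<in>prime_factors C. n)"
    by (intro prod_mono) (auto intro!: le multiplicity_dvd simp: in_prime_factors_iff)
  also have "\<dots> = n ^ card (prime_factors C)" by simp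
  also have "\<dots> \<le> n ^ num_primes n"
    unfolding num_primes_def using sub assms by (intro power_increasing card_mono) auto
  finally show ?thesis by (simp add: C_def)
qed

text \<open>Combine the previous bound with the lower bound \<open>4 ^ n / (2 * n)\<close> for the
  central binomial coefficient. With \<open>2 * n = 2 ^ m\<close> both sides are powers of two, and
  exponents are compared without logarithms.\<close>

lemma num_primes_pow_two_lower:
  assumes "1 \<le> m"
  shows "2 ^ m \<le> m * num_primes (2 ^ m) + m"
proof -
  define n :: nat where "n = 2 ^ (m - 1)"
  have n: "2 * n = 2 ^ m" "n > 0" using assms by (cases m; simp add: n_def)+
  have "4 ^ n / (2 * real n) \<le> real ((2 * n) choose n)"
    by (rule central_binomial_lower_bound[OF n(2)])
  then have "4 ^ n \<le> real ((2 * n) choose n) * (2 * real n)"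
    using n by (simp add: divide_simps)
  then have "4 ^ n \<le> ((2 * n) choose n) * (2 * n)"
    by (metis (mono_tags) of_nat_le_iff of_nat_mult of_nat_numeral of_nat_power)
  also have "\<dots> \<le> (2 * n) ^ num_primes (2 * n) * (2 * n)"
    using n by (intro mult_right_mono choose_le_power_num_primes) auto
  also have "\<dots> = 2 ^ (m * num_primes (2 ^ m) + m)"
    unfolding n(1) by (simp add: power_add power_mult)
  also have "(4::nat) ^ n = 2 ^ (2 ^ m)" by (simp add: power_mult flip: n(1))
  finally show ?thesis by (simp only: power_increasing_iff)
qed

text \<open>With \<open>n = 2 ^ m\<close>, every prime in \<open>(n, 2 * n]\<close> divides the
  central binomial coefficient, which is at most \<open>4 ^ n\<close>, while the product of these
  primes is at least \<open>n ^ card P\<close>.\<close>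

lemma num_primes_pow_two_step:
  "m * num_primes (2 ^ Suc m) \<le> m * num_primes (2 ^ m) + 2 ^ Suc m"
proof -
  define n :: nat where "n = 2 ^ m"
  define P where "P = {p. prime p \<and> n < p \<and> p \<le> 2 * n}"
  have fin: "finite P" by (rule finite_subset[of _ "{..2 * n}"]) (auto simp: P_def)
  have split: "{p. prime p \<and> p \<le> 2 * n} = {p. prime p \<and> p \<le> n} \<union> P"
    by (auto simp: P_def)
  have card: "num_primes (2 * n) = num_primes n + card P"
    unfolding num_primes_def split by (rule card_Un_disjoint) (auto simp: fin P_def)
  have dvd: "p dvd (2 * n) choose n" if "p \<in> P" for p
  proof -
    have p: "prime p" "n < p" "p \<le> 2 * n" using that by (auto simp: P_def)
    have "p dvd fact (2 * n)" using p by (simp add: prime_dvd_fact_iff)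
    moreover have "fact n * fact n * ((2 * n) choose n) = (fact (2 * n) :: nat)"
      using binomial_fact_lemma[of n "2 * n"] by (simp add: mult_2)
    ultimately have "p dvd fact n * fact n * ((2 * n) choose n)" by simp
    then show ?thesis using p by (simp add: prime_dvd_mult_iff prime_dvd_fact_iff)
  qed
  have "n ^ card P = (\<Prod>p\<in>P. n)" by simp
  also have "\<dots> \<le> \<Prod>P" by (rule prod_mono) (auto simp: P_def)
  also have "\<Prod>P dvd (2 * n) choose n"
  proof -
    have "A \<subseteq> P \<Longrightarrow> \<Prod>A dvd (2 * n) choose n" if "finite A" for A
      using that
    proof (induction A)
      case (insert x A)
      have "coprime x (\<Prod>A)"
        using insert by (intro prod_coprime_right) (auto simp: P_def intro!: primes_coprime)
      then show ?case using insert dvd by (auto intro!: divides_mult)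
    qed simp
    then show ?thesis using fin by blast
  qed
  then have "\<Prod>P \<le> (2 * n) choose n" by (rule dvd_imp_le) simp
  also have "\<dots> \<le> 2 ^ (2 * n)" by (rule binomial_le_pow2)
  finally have "2 ^ (m * card P) \<le> (2::nat) ^ (2 * n)" by (simp add: n_def power_mult)
  then have "m * card P \<le> 2 * n" by (simp only: power_increasing_iff)
  then show ?thesis using card by (simp add: n_def algebra_simps)
qed

lemma num_primes_pow_two_upper:
  assumes "3 \<le> m"
  shows "m * num_primes (2 ^ m) \<le> 4 * 2 ^ m"
  using assms
proof (induction m rule: dec_induct)
  case base
  have "num_primes 8 \<le> card {1..8::nat}"
    unfolding num_primes_def by (intro card_mono) (auto dest: prime_gt_0_nat)
  then show ?case by simp
next
  case (step m)
  let ?x = "num_primes (2 ^ Suc m)"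
  have "m * ?x \<le> 6 * 2 ^ m" using num_primes_pow_two_step[of m] step by simp
  then have "Suc m * (m * ?x) \<le> Suc m * (6 * 2 ^ m)" by (rule mult_left_mono) simp
  \<comment> \<open>This is \<open>6 * (m + 1) \<le> 8 * m\<close>, the reason for starting at
    3.\<close>
  also have "\<dots> \<le> m * (8 * 2 ^ m)" using step by simp
  finally have "m * (Suc m * ?x) \<le> m * (8 * 2 ^ m)" by (simp add: algebra_simps)
  then show ?case using step by simp
qed

text \<open>The Chebyshev constants 4 and 1 differ by a factor 4, so a jump by 16 leaves a growth of
  nearly 4; the surplus over 3 pays for \<open>k / (k + 1)\<close> and the additive error once
  \<open>k \<ge> 4\<close>.\<close>

lemma num_primes_pow_sixteen_growth:
  assumes "4 \<le> k"
  shows "3 * num_primes (16 ^ k) \<le> num_primes (16 ^ Suc k)"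
proof -
  define N :: nat where "N = 16 ^ k"
  have p2: "(16::nat) ^ i = 2 ^ (4 * i)" for i by (simp add: power_mult)
  have kN: "k * (k + 1) \<le> N"
  proof -
    have "k + 1 \<le> 4 ^ k" by (induction k) auto
    then have "k \<le> 4 ^ k" by simp
    then have "k * (k + 1) \<le> 4 ^ k * 4 ^ k" using \<open>k + 1 \<le> 4 ^ k\<close> by (rule mult_le_mono)
    then show ?thesis by (simp add: N_def flip: power_mult_distrib)
  qed
  have "(4 * k) * num_primes N \<le> 4 * N"
    unfolding N_def p2 using assms by (intro num_primes_pow_two_upper) auto
  then have u: "k * num_primes N \<le> N" by simp
  have "16 * N \<le> (4 * (k + 1)) * num_primes (16 ^ Suc k) + 4 * (k + 1)"
    using num_primes_pow_two_lower[of "4 * Suc k"] unfolding N_def p2 by (simp add: power_add)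
  then have l: "4 * N \<le> (k + 1) * num_primes (16 ^ Suc k) + (k + 1)" by (simp add: algebra_simps)
  have "(k + 1) * k * (3 * num_primes N) \<le> 3 * k * N + 3 * N"
    using mult_left_mono[OF u, of "3 * (k + 1)"] by (simp add: algebra_simps)
  moreover have "3 * k * N + 3 * N + N \<le> 4 * k * N"
    using mult_right_mono[OF assms, of N] by (simp add: algebra_simps)
  moreover have "4 * k * N \<le> (k + 1) * k * num_primes (16 ^ Suc k) + k * (k + 1)"
    using mult_left_mono[OF l, of k] by (simp add: algebra_simps)
  ultimately have "(k + 1) * k * (3 * num_primes N) \<le> (k + 1) * k * num_primes (16 ^ Suc k)"
    using kN by linarith
  then show ?thesis using assms by (simp add: N_def)
qed

section \<open>Oscillation of the relative count along powers of 16\<close>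

lemma primes_in_alternating_blocks_no_density:
  assumes S: "S = {p. prime p \<and> (\<exists>j. 16 ^ (2 * j) < p \<and> p \<le> 16 ^ (2 * j + 1))}"
  shows "\<not> has_natural_density S"
proof
  assume "has_natural_density S"
  then obtain d where d:
    "(\<lambda>n. real (count_upto S (real n)) / real (prime_count (real n))) \<longlonglongrightarrow> d"
    unfolding has_natural_density_def by blast
  define A where "A k = card {q \<in> S. q \<le> 16 ^ k}" for k :: nat
  define P where "P k = num_primes (16 ^ k)" for k :: nat
  \<comment> \<open>The cases \<open>c = 0\<close> and \<open>c = 1\<close> give the even and odd
    powers of 16, with the same limit.\<close>
  have lim: "(\<lambda>j. real (A (2 * j + c)) / real (P (2 * j + c))) \<longlonglongrightarrow> d" for c
  proof -
    have "strict_mono (\<lambda>j::nat. (16::nat) ^ (2 * j + c))"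
      by (intro strict_monoI) (simp add: power_strict_increasing)
    from LIMSEQ_subseq_LIMSEQ[OF d this] show ?thesis
      unfolding o_def count_upto_def prime_count_def A_def P_def num_primes_def
      by (simp only: of_nat_le_iff)
  qed
  have fin: "finite {p. prime p \<and> p \<le> n}" for n :: nat
    by (rule finite_subset[of _ "{..n}"]) auto
  have growth: "3 * P k \<le> P (Suc k)" if "4 \<le> k" for k
    using num_primes_pow_sixteen_growth[OF that] by (simp add: P_def)
  have pos: "P k > 0" if "1 \<le> k" for k
  proof -
    have "(16::nat) ^ 1 \<le> 16 ^ k" using that by (intro power_increasing) auto
    then have "2 \<in> {p. prime p \<and> p \<le> (16::nat) ^ k}" by simp
    then show ?thesis unfolding P_def num_primes_def using fin card_gt_0_iff by blast
  qed
  \<comment> \<open>For odd \<open>k\<close> the block \<open>(16 ^ k, 16 ^ (k + 1)]\<close>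
    contains no element of \<open>S\<close>.\<close>
  have even_le: "A (Suc k) \<le> P k" if "odd k" for k
    unfolding A_def P_def num_primes_def
  proof (intro card_mono fin subsetI)
    fix q assume "q \<in> {q \<in> S. q \<le> 16 ^ Suc k}"
    then obtain j where q: "prime q" "q \<le> 16 ^ Suc k" "16 ^ (2 * j) < q" "q \<le> 16 ^ (2 * j + 1)"
      by (auto simp: S)
    then have "(16::nat) ^ (2 * j) < 16 ^ Suc k" by linarith
    then have "2 * j < Suc k" by (simp only: power_strict_increasing_iff)
    then have "2 * j + 1 \<le> k" using that by presburger
    then have "(16::nat) ^ (2 * j + 1) \<le> 16 ^ k" by (intro power_increasing) auto
    then show "q \<in> {p. prime p \<and> p \<le> 16 ^ k}" using q by simp
  qed
  \<comment> \<open>For even \<open>k\<close> all primes of the block belong to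
    \<open>S\<close>.\<close>
  have odd_ge: "P (Suc k) \<le> A (Suc k) + P k" if "even k" for k
  proof -
    have "{p. prime p \<and> p \<le> 16 ^ Suc k} \<subseteq> {q \<in> S. q \<le> 16 ^ Suc k} \<union> {p. prime p \<and> p \<le> 16 ^ k}"
    proof
      fix q :: nat assume q: "q \<in> {p. prime p \<and> p \<le> 16 ^ Suc k}"
      obtain b where b: "k = 2 * b" using \<open>even k\<close> by blast
      have "q \<in> S" if "\<not> q \<le> 16 ^ k" using that q b
        unfolding S by (intro CollectI conjI exI[of _ b]) auto
      then show "q \<in> {q \<in> S. q \<le> 16 ^ Suc k} \<union> {p. prime p \<and> p \<le> 16 ^ k}" using q by blast
    qed
    moreover have "finite {q \<in> S. q \<le> 16 ^ Suc k}"
      by (rule finite_subset[of _ "{..16 ^ Suc k}"]) auto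
    ultimately show ?thesis
      unfolding A_def P_def num_primes_def
      using card_mono[of "{q \<in> S. q \<le> 16 ^ Suc k} \<union> {p. prime p \<and> p \<le> 16 ^ k}"] card_Un_le fin
      by (meson finite_UnI order_trans)
  qed
  have "d \<le> 1 / 3"
  proof (rule LIMSEQ_le_const2[OF lim[of 0]], intro exI[of _ 3] allI impI)
    \<comment> \<open>From \<open>j = 3\<close> on, the exponent \<open>2 * j - 1\<close> is in the
      range of \<open>growth\<close>; for the odd powers below, \<open>2 * j\<close> is so from
      \<open>j = 2\<close> on.\<close>
    fix j :: nat assume j: "3 \<le> j"
    define k where "k = 2 * j - 1"
    have k: "odd k" "4 \<le> k" "2 * j + 0 = Suc k" using j by (auto simp: k_def)
    have "3 * A (Suc k) \<le> P (Suc k)" using even_le growth k by fastforce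
    then show "real (A (2 * j + 0)) / real (P (2 * j + 0)) \<le> 1 / 3"
      unfolding k using pos[of "Suc k"] by (simp add: divide_simps)
  qed
  moreover have "2 / 3 \<le> d"
  proof (rule LIMSEQ_le_const[OF lim[of 1]], intro exI[of _ 2] allI impI)
    fix j :: nat assume j: "2 \<le> j"
    have "2 * P (Suc (2 * j)) \<le> 3 * A (Suc (2 * j))"
      using odd_ge[of "2 * j"] growth[of "2 * j"] j by simp
    then show "2 / 3 \<le> real (A (2 * j + 1)) / real (P (2 * j + 1))"
      using pos[of "Suc (2 * j)"] by (simp add: divide_simps)
  qed
  ultimately show False by simp
qed

theorem theorem8p1:
  shows "\<exists>\<psi>. sentence \<psi> \<and> \<not> has_natural_density (prime_spectrum \<psi>)"
  using sentence_even_log primes_in_alternating_blocks_no_density[OF prime_spectrum_even_log] by blast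

end
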